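(* Let $n \ge 1$, let $\lambda = (\lambda_1,\ldots,\lambda_n)$ and $\mu = (\mu_1,\ldots,\mu_n)$ be integer partitions such that $\lambda \prec \mu$ (i.e. $\lambda$ is majorized by $\mu$), and let $\bm{x} = (x_1,\ldots,x_n) \in \mathbb{R}^n$ with $x_i \ge 0$ for all $i$. Then the normalized Schur functions satisfy $$S_\lambda(\bm{x}) \le S_\mu(\bm{x}).$$
   Context: An integer partition is a tuple $\lambda=(\lambda_1,\ldots,\lambda_n)$ of nonnegative integers with $\lambda_1 \ge \cdots \ge \lambda_n$ (zero entries allowed). The Schur function (Schur polynomial) in $n$ real variables indexed by $\lambda$ is $$s_\lambda(\bm{x}) = s_\lambda(x_1,\ldots,x_n) := \frac{\det\big([x_i^{\lambda_j+n-j}]_{i,j=1}^n\big)}{\det\big([x_i^{n-j}]_{i,j=1}^n\big)}.$$ This ratio is a symmetric polynomial in $x_1,\ldots,x_n$, and $s_\lambda$ denotes that polynomial; in particular it is defined also when some of the $x_i$ coincide. The normalized Schur function is $$S_\lambda(\bm{x}) := \frac{s_\lambda(x_1,\ldots,x_n)}{s_\lambda(1,\ldots,1)},$$ with $n$ ones in the denominator. Majorization (dominance order): for decreasingly ordered $\lambda,\mu\in\mathbb{R}^n$, we write $\lambda \prec \mu$ and say $\lambda$ is majorized by $\mu$ if $\sum_{i=1}^k \lambda_i \le \sum_{i=1}^k \mu_i$ for all $1 \le k \le n-1$, and $\sum_{i=1}^n \lambda_i = \sum_{i=1}^n \mu_i$. *)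

theory Defs
  imports Complex_Main "Jordan_Normal_Form.Determinant"
begin

text \<open>
  An n-tuple is a function on \<open>nat\<close>, of which only the entries at \<open>0, \<dots>, n - 1\<close> matter;
  the entry at \<open>i\<close> is the one usually written with subscript \<open>i + 1\<close>.
\<close>

definition int_partition :: "nat \<Rightarrow> (nat \<Rightarrow> nat) \<Rightarrow> bool" where
  "int_partition n l \<longleftrightarrow> antimono_on {..<n} l"

definition majorized :: "nat \<Rightarrow> (nat \<Rightarrow> real) \<Rightarrow> (nat \<Rightarrow> real) \<Rightarrow> bool" where
  "majorized n a b \<longleftrightarrow>
     (\<forall>k\<in>{1..n - 1}. (\<Sum>i<k. a i) \<le> (\<Sum>i<k. b i)) \<and> (\<Sum>i<n. a i) = (\<Sum>i<n. b i)"

definition polynomial_fun :: "nat \<Rightarrow> ((nat \<Rightarrow> real) \<Rightarrow> real) \<Rightarrow> bool" where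
  "polynomial_fun n f \<longleftrightarrow>
     (\<exists>(M :: (nat \<Rightarrow> nat) set) c. finite M \<and> (\<forall>x. f x = (\<Sum>m\<in>M. c m * (\<Prod>i<n. x i ^ m i))))"

definition alternant :: "nat \<Rightarrow> (nat \<Rightarrow> nat) \<Rightarrow> (nat \<Rightarrow> real) \<Rightarrow> real" where
  "alternant n a x = det (mat n n (\<lambda>(i, j). x i ^ a j))"

text \<open>
  The quotient of alternants only makes sense at points with pairwise distinct coordinates
  (elsewhere the denominator, a Vandermonde determinant, vanishes).  The Schur polynomial is the
  polynomial function with these values; there is only one, as such points are dense.
  With indices starting from 0, the exponent \<open>n - j\<close> becomes \<open>n - Suc j\<close>.
\<close>

definition schur :: "nat \<Rightarrow> (nat \<Rightarrow> nat) \<Rightarrow> (nat \<Rightarrow> real) \<Rightarrow> real" where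
  "schur n l = (THE f. polynomial_fun n f \<and>
     (\<forall>x. inj_on x {..<n} \<longrightarrow>
        f x = alternant n (\<lambda>j. l j + (n - Suc j)) x / alternant n (\<lambda>j. n - Suc j) x))"

definition normalized_schur :: "nat \<Rightarrow> (nat \<Rightarrow> nat) \<Rightarrow> (nat \<Rightarrow> real) \<Rightarrow> real" where
  "normalized_schur n l x = schur n l x / schur n l (\<lambda>_. 1)"

end

theory Submission
  imports Defs "HOL-Analysis.Convex"
begin

text \<open>
  Write \<open>V\<close> for the Vandermonde determinant, \<open>\<delta> = (n - 1, \<dots>, 1, 0)\<close>, and \<open>r\<^sup>a\<close> for the point
  with coordinates \<open>r ^ a i\<close>.  The normalized Schur polynomial \<open>s\<^sub>\<lambda>(x) / s\<^sub>\<lambda>(1, \<dots>, 1)\<close> is the limit,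
  as \<open>r\<close> decreases to 1, of \<open>s\<^sub>\<lambda>(r\<^sup>a) / s\<^sub>\<lambda>(r\<^sup>\<delta>)\<close>, where the strictly decreasing integer exponents
  \<open>a\<close> depend on \<open>r\<close> and are chosen such that \<open>r\<^sup>a\<close> tends to \<open>x\<close>.  At such points the roles of
  variables and exponents can be exchanged, because \<open>(r ^ a i) ^ b j = (r ^ b j) ^ a i\<close>.
  If \<open>p\<close> is the Schur polynomial with alternant exponents \<open>a\<close>, transposing the alternants gives

  \<open>s\<^sub>\<lambda>(r\<^sup>a) / s\<^sub>\<lambda>(r\<^sup>\<delta>) = (V(r\<^sup>\<delta>) / V(r\<^sup>a)) p(r\<^bsup>\<lambda>+\<delta>\<^esup>)\<close>.

  The first factor on the right is positive and does not involve \<open>\<lambda>\<close>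
  (lemma \<open>schur_ratio_at_powers\<close>), so it suffices that \<open>p(r\<^sup>l)\<close> is Schur-convex in \<open>l\<close>.

  This is easy: \<open>p\<close> is symmetric, and it is a sum of monomials
  (lemma \<open>alternant_factorization\<close>), so that \<open>p(r\<^sup>l)\<close> is a sum of exponentials of linear functions
  of \<open>l\<close> and hence convex.  Moving one unit from a larger entry of \<open>l\<close> to a smaller one replaces
  \<open>l\<close> by a convex combination of \<open>l\<close> and its image under a transposition, so it does not increase
  \<open>p(r\<^sup>l)\<close> (lemma \<open>unit_transfer_le\<close>).  Finitely many such moves lead from a partition to
  any partition that it majorizes (lemma \<open>majorization_le\<close>).

  The points reached as limits of \<open>r\<^sup>a\<close> have decreasing coordinates above 1.  Symmetry and
  homogeneity of Schur polynomials extend the inequality to all points with distinct positive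
  coordinates, and continuity to all points with nonnegative coordinates.
\<close>

section \<open>Alternants\<close>

lemma alternant_Leibniz:
  "alternant n a x = (\<Sum>p | p permutes {0..<n}. signof p * (\<Prod>j<n. x (p j) ^ a j))"
  unfolding alternant_def
proof (subst det_col[where n = n])
  have "signof p * (\<Prod>j<n. mat n n (\<lambda>(i, j). x i ^ a j) $$ (p j, j)) =
      signof p * (\<Prod>j<n. x (p j) ^ a j)" if "p permutes {0..<n}" for p
  proof -
    have "p j < n" if "j < n" for j
      using permutes_in_image[OF \<open>p permutes {0..<n}\<close>, of j] that by simp
    then show ?thesis by (intro arg_cong2[where f = "(*)"] prod.cong) auto
  qed
  then show "(\<Sum>p | p permutes {0..<n}. signof p * (\<Prod>j<n. mat n n (\<lambda>(i, j). x i ^ a j) $$ (p j, j)))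
      = (\<Sum>p | p permutes {0..<n}. signof p * (\<Prod>j<n. x (p j) ^ a j))"
    by (intro sum.cong) auto
qed auto

lemma alternant_cong:
  assumes "\<And>i. i < n \<Longrightarrow> a i = b i" "\<And>i. i < n \<Longrightarrow> x i = y i"
  shows "alternant n a x = alternant n b y"
  unfolding alternant_def by (intro arg_cong[where f = det] eq_matI) (auto simp: assms)

lemma alternant_permute:
  assumes "p permutes {0..<n}"
  shows "alternant n a (\<lambda>i. x (p i)) = signof p * alternant n a x"
proof -
  have "p i < n" if "i < n" for i
    using permutes_in_image[OF assms, of i] that by simp
  then have "mat n n (\<lambda>(i, j). x (p i) ^ a j) =
      mat n n (\<lambda>(i, j). mat n n (\<lambda>(i, j). x i ^ a j) $$ (p i, j))"
    by (intro eq_matI) auto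
  then show ?thesis
    unfolding alternant_def using det_permute_rows[OF _ assms, of "mat n n (\<lambda>(i, j). x i ^ a j)"]
    by simp
qed

lemma alternant_scale: "alternant n a (\<lambda>i. c * x i) = c ^ (\<Sum>j<n. a j) * alternant n a x"
  unfolding alternant_Leibniz
  by (simp add: power_mult_distrib prod.distrib power_sum sum_distrib_left mult_ac)

text \<open>
  The exchange of variables and exponents on which the whole proof rests: both sides are
  determinants of the matrix with entries \<open>r ^ (a j * b i)\<close>, up to transposition.
\<close>

lemma alternant_swap_powers:
  "alternant n a (\<lambda>i. r ^ b i) = alternant n b (\<lambda>i. r ^ a i)"
proof -
  have "transpose_mat (mat n n (\<lambda>(i, j). (r ^ b i) ^ a j)) = mat n n (\<lambda>(i, j). (r ^ a i) ^ b j)"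
    by (intro eq_matI) (auto simp: power_mult[symmetric] mult.commute)
  then show ?thesis
    unfolding alternant_def using det_transpose[of "mat n n (\<lambda>(i, j). (r ^ b i) ^ a j)" n]
    by simp
qed

lemma power_diff_geometric:
  fixes x y :: real
  assumes "b < a"
  shows "x ^ a - y ^ (a - b) * x ^ b = (x - y) * (\<Sum>k\<in>{b..<a}. y ^ (a - 1 - k) * x ^ k)"
proof -
  have "x ^ a - y ^ (a - b) * x ^ b = x ^ b * (x ^ (a - b) - y ^ (a - b))"
    using assms by (simp add: algebra_simps flip: power_add)
  also have "\<dots> = (x - y) * (\<Sum>k<a - b. y ^ (a - b - Suc k) * x ^ (k + b))"
    by (simp add: power_diff_sumr2 sum_distrib_left power_add mult_ac)
  also have "(\<Sum>k<a - b. y ^ (a - b - Suc k) * x ^ (k + b)) = (\<Sum>k\<in>{b..<a}. y ^ (a - 1 - k) * x ^ k)"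
    using assms
    by (intro sum.reindex_bij_witness[of _ "\<lambda>k. k - b" "\<lambda>k. k + b"]) (auto simp: diff_diff_add add.commute)
  finally show ?thesis .
qed

text \<open>
  Branching of alternants: subtracting from each column the multiple of the next one that
  annihilates its last entry turns the other entries into differences of powers, each of which is
  \<open>x i - x n\<close> times a geometric sum.  Expanding the geometric sums by multilinearity in the columns
  leaves the smaller alternants whose exponents interlace with \<open>l\<close>.  All coefficients are
  monomials in \<open>x n\<close>; this is the source of positivity.
\<close>

lemma alternant_branch:
  assumes l: "strict_antimono_on {..<Suc n} l"
  shows "alternant (Suc n) l x = (\<Prod>i<n. x i - x n) *
    (\<Sum>k\<in>PiE {..<n} (\<lambda>j. {l (Suc j)..<l j}).
      x n ^ (l n + (\<Sum>j<n. l j - 1 - k j)) * alternant n k x)"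
proof -
  let ?y = "x n"
  let ?I = "\<lambda>j. {l (Suc j)..<l j}"
  have dec: "l (Suc j) < l j" if "j < n" for j
    using monotone_onD[OF l, of j "Suc j"] that by auto
  define A where "A = mat (Suc n) (Suc n) (\<lambda>(i, j). x i ^ l j)"
  \<comment> \<open>Multiplication by \<open>U\<close> from the right performs the column operations.\<close>
  define U where "U = mat (Suc n) (Suc n) (\<lambda>(i, j).
    if i = j then 1 else if i = Suc j then - (?y ^ (l j - l (Suc j))) else 0)"
  define C where "C = mat n n (\<lambda>(i, j). (x i - ?y) * (\<Sum>k\<in>?I j. ?y ^ (l j - 1 - k) * x i ^ k))"
  have carr: "A \<in> carrier_mat (Suc n) (Suc n)" "U \<in> carrier_mat (Suc n) (Suc n)"
      "A * U \<in> carrier_mat (Suc n) (Suc n)" "C \<in> carrier_mat n n"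
    by (auto simp: A_def U_def C_def)
  have "det U = 1"
    by (subst det_lower_triangular[OF _ carr(2)])
      (auto simp: U_def prod_list_diag_prod intro!: prod.neutral)
  have AU: "(A * U) $$ (i, j) = x i ^ l j - (if j < n then ?y ^ (l j - l (Suc j)) * x i ^ l (Suc j) else 0)"
    if "i \<le> n" "j \<le> n" for i j
  proof -
    have "(A * U) $$ (i, j) = (\<Sum>k<Suc n. x i ^ l k *
        (if k = j then 1 else if k = Suc j then - (?y ^ (l j - l (Suc j))) else 0))"
      using that by (simp add: A_def U_def scalar_prod_def lessThan_atLeast0)
    also have "\<dots> = (\<Sum>k<Suc n. (if k = j then x i ^ l j else 0) +
        (if k = Suc j then - (?y ^ (l j - l (Suc j)) * x i ^ l (Suc j)) else 0))"
      by (intro sum.cong) auto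
    also have "\<dots> = x i ^ l j - (if j < n then ?y ^ (l j - l (Suc j)) * x i ^ l (Suc j) else 0)"
      using that unfolding sum.distrib by (subst (1 2) sum.delta) auto
    finally show ?thesis .
  qed
  have last_row: "(A * U) $$ (n, j) = (if j = n then ?y ^ l n else 0)" if "j \<le> n" for j
    using AU[of n j] that dec[of j] by (auto simp flip: power_add)
  have "mat_delete (A * U) n n = C"
    using carr by (intro eq_matI)
      (auto simp: mat_delete_def C_def AU power_diff_geometric[OF dec] simp del: index_mult_mat(1))
  then have "det (A * U) = ?y ^ l n * det C"
    by (subst laplace_expansion_row[OF carr(3), of n])
      (simp_all add: last_row cofactor_def)
  then have "alternant (Suc n) l x = ?y ^ l n * det C"
    using det_mult[OF carr(1,2)] \<open>det U = 1\<close> by (simp add: alternant_def A_def)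
  also have "det C = (\<Sum>p | p permutes {0..<n}. signof p *
      (\<Prod>j<n. (x (p j) - ?y) * (\<Sum>k\<in>?I j. ?y ^ (l j - 1 - k) * x (p j) ^ k)))"
    unfolding det_col[OF carr(4)]
  proof (intro sum.cong refl arg_cong2[where f = "(*)"] prod.cong)
    fix p j assume "p \<in> {p. p permutes {0..<n}}" "j \<in> {..<n}"
    then show "C $$ (p j, j) = (x (p j) - ?y) * (\<Sum>k\<in>?I j. ?y ^ (l j - 1 - k) * x (p j) ^ k)"
      using permutes_in_image[of p "{0..<n}" j] by (auto simp: C_def)
  qed
  also have "\<dots> = (\<Sum>p | p permutes {0..<n}. signof p * ((\<Prod>i<n. x i - ?y) *
      (\<Sum>k\<in>PiE {..<n} ?I. ?y ^ (\<Sum>j<n. l j - 1 - k j) * (\<Prod>j<n. x (p j) ^ k j))))"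
  proof (intro sum.cong refl arg_cong2[where f = "(*)"])
    fix p assume "p \<in> {p. p permutes {0..<n}}"
    then have p: "p permutes {..<n}" by (simp add: lessThan_atLeast0)
    show "(\<Prod>j<n. (x (p j) - ?y) * (\<Sum>k\<in>?I j. ?y ^ (l j - 1 - k) * x (p j) ^ k)) =
      (\<Prod>i<n. x i - ?y) * (\<Sum>k\<in>PiE {..<n} ?I. ?y ^ (\<Sum>j<n. l j - 1 - k j) * (\<Prod>j<n. x (p j) ^ k j))"
      using prod.permute[OF p, of "\<lambda>i. x i - ?y"]
      by (simp add: prod.distrib prod_sum_PiE power_sum comp_def)
  qed
  also have "\<dots> = (\<Prod>i<n. x i - ?y) * (\<Sum>k\<in>PiE {..<n} ?I. ?y ^ (\<Sum>j<n. l j - 1 - k j) * alternant n k x)"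
    unfolding alternant_Leibniz sum_distrib_left
    by (subst sum.swap) (simp add: mult_ac)
  finally show ?thesis
    by (simp add: sum_distrib_left power_add mult_ac)
qed

abbreviation staircase :: "nat \<Rightarrow> nat \<Rightarrow> nat" where
  "staircase n \<equiv> \<lambda>j. n - Suc j"

abbreviation vandermonde :: "nat \<Rightarrow> (nat \<Rightarrow> real) \<Rightarrow> real" where
  "vandermonde n \<equiv> alternant n (staircase n)"

text \<open>
  Exactly one exponent sequence interlaces with the staircase, namely the shorter staircase, and
  the power of the new variable that goes with it is 0.
\<close>

lemma vandermonde_Suc: "vandermonde (Suc n) x = (\<Prod>i<n. x i - x n) * vandermonde n x"
proof -
  let ?k = "restrict (staircase n) {..<n}"
  have "PiE {..<n} (\<lambda>j. {staircase (Suc n) (Suc j)..<staircase (Suc n) j}) = PiE {..<n} (\<lambda>j. {?k j})"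
    by (intro PiE_cong) (auto simp: Suc_diff_Suc[symmetric])
  also have "\<dots> = {?k}"
    by (rule PiE_singleton) (rule restrict_extensional)
  finally have "vandermonde (Suc n) x = (\<Prod>i<n. x i - x n) *
      (x n ^ (\<Sum>j<n. staircase (Suc n) j - 1 - ?k j) * alternant n ?k x)"
    by (subst alternant_branch) (auto simp: monotone_on_def)
  also have "alternant n ?k x = vandermonde n x"
    by (rule alternant_cong) auto
  finally show ?thesis by simp
qed

lemma vandermonde_nonzero: "inj_on x {..<n} \<Longrightarrow> vandermonde n x \<noteq> 0"
proof (induction n)
  case 0
  then show ?case by (simp add: alternant_def)
next
  case (Suc n)
  then show ?case by (subst vandermonde_Suc) (auto simp: inj_on_def)
qed

lemma vandermonde_pos: "strict_antimono_on {..<n} x \<Longrightarrow> vandermonde n x > 0"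
proof (induction n)
  case 0
  then show ?case by (simp add: alternant_def)
next
  case (Suc n)
  then show ?case
    by (subst vandermonde_Suc) (auto simp: monotone_on_def intro!: mult_pos_pos prod_pos)
qed

section \<open>Sums of monomials\<close>

text \<open>
  Polynomials with natural coefficients; the list records each monomial as often as its coefficient
  says, so that sums of polynomials are concatenations of lists.
\<close>

definition monomial_sum :: "nat \<Rightarrow> ((nat \<Rightarrow> real) \<Rightarrow> real) \<Rightarrow> bool" where
  "monomial_sum n f \<longleftrightarrow> (\<exists>ms. \<forall>x. f x = (\<Sum>m\<leftarrow>ms. \<Prod>i<n. x i ^ m i))"

lemma monomial_sum_sum:
  assumes "finite K" "\<And>k. k \<in> K \<Longrightarrow> monomial_sum n (f k)"
  shows "monomial_sum n (\<lambda>x. \<Sum>k\<in>K. f k x)"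
  using assms
proof (induction K)
  case empty
  show ?case unfolding monomial_sum_def by (rule exI[of _ "[]"]) simp
next
  case (insert k K)
  then have "monomial_sum n (f k)" "monomial_sum n (\<lambda>x. \<Sum>k\<in>K. f k x)"
    by simp_all
  then obtain ms ms' where "\<forall>x. f k x = (\<Sum>m\<leftarrow>ms. \<Prod>i<n. x i ^ m i)"
      "\<forall>x. (\<Sum>k\<in>K. f k x) = (\<Sum>m\<leftarrow>ms'. \<Prod>i<n. x i ^ m i)"
    unfolding monomial_sum_def by blast
  with insert.hyps show ?case
    unfolding monomial_sum_def by (intro exI[of _ "ms @ ms'"]) simp
qed

lemma monomial_sum_new_variable:
  assumes "monomial_sum n f"
  shows "monomial_sum (Suc n) (\<lambda>x. x n ^ e * f x)"
proof -
  obtain ms where ms: "\<And>x. f x = (\<Sum>m\<leftarrow>ms. \<Prod>i<n. x i ^ m i)"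
    using assms unfolding monomial_sum_def by blast
  have "x n ^ e * f x = (\<Sum>m\<leftarrow>map (\<lambda>m. m(n := e)) ms. \<Prod>i<Suc n. x i ^ m i)" for x
    by (simp add: ms comp_def mult.commute flip: sum_list_const_mult)
  then show ?thesis unfolding monomial_sum_def by blast
qed

lemma monomial_sum_imp_polynomial_fun:
  assumes "monomial_sum n f"
  shows "polynomial_fun n f"
proof -
  obtain ms where ms: "\<And>x. f x = (\<Sum>m\<leftarrow>ms. \<Prod>i<n. x i ^ m i)"
    using assms unfolding monomial_sum_def by blast
  have "(\<Sum>m\<leftarrow>ms. g m) = (\<Sum>m\<in>set ms. real (count_list ms m) * g m)" for g :: "_ \<Rightarrow> real"
  proof (induction ms)
    case (Cons m ms)
    have "(\<Sum>k\<leftarrow>m # ms. g k) = g m + (\<Sum>k\<in>insert m (set ms). real (count_list ms k) * g k)"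
      using Cons.IH by (auto simp: sum.insert_if)
    also have "\<dots> = (\<Sum>k\<in>insert m (set ms). (if k = m then g k else 0) + real (count_list ms k) * g k)"
      unfolding sum.distrib by (subst sum.delta) auto
    also have "\<dots> = (\<Sum>k\<in>set (m # ms). real (count_list (m # ms) k) * g k)"
      by (intro sum.cong) (auto simp: algebra_simps)
    finally show ?case .
  qed simp
  then show ?thesis
    unfolding polynomial_fun_def
    by (intro exI[of _ "set ms"] exI[of _ "\<lambda>m. real (count_list ms m)"]) (auto simp: ms)
qed

lemma monomial_sum_one_pos:
  assumes "monomial_sum n f" "f x \<noteq> 0"
  shows "f (\<lambda>_. 1) > 0"
proof -
  obtain ms where ms: "\<And>x. f x = (\<Sum>m\<leftarrow>ms. \<Prod>i<n. x i ^ m i)"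
    using assms unfolding monomial_sum_def by blast
  with assms(2) have "ms \<noteq> []" by auto
  then show ?thesis by (simp add: ms sum_list_triv)
qed

text \<open>
  In logarithmic coordinates a monomial is the exponential of a linear function.
\<close>

lemma monomial_sum_exp_convex:
  assumes "monomial_sum n f" "0 \<le> t" "t \<le> 1"
  shows "f (\<lambda>i. exp ((1 - t) * a i + t * b i)) \<le>
    (1 - t) * f (\<lambda>i. exp (a i)) + t * f (\<lambda>i. exp (b i))"
proof -
  obtain ms where ms: "\<And>x. f x = (\<Sum>m\<leftarrow>ms. \<Prod>i<n. x i ^ m i)"
    using assms unfolding monomial_sum_def by blast
  have exp_monomial: "(\<Prod>i<n. exp (c i) ^ m i) = exp (\<Sum>i<n. real (m i) * c i)"
    for c :: "nat \<Rightarrow> real" and m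
    by (simp add: exp_sum exp_of_nat_mult)
  have "(\<Prod>i<n. exp ((1 - t) * a i + t * b i) ^ m i) \<le>
      (1 - t) * (\<Prod>i<n. exp (a i) ^ m i) + t * (\<Prod>i<n. exp (b i) ^ m i)" for m
  proof -
    have "(\<Sum>i<n. real (m i) * ((1 - t) * a i + t * b i)) =
        (1 - t) * (\<Sum>i<n. real (m i) * a i) + t * (\<Sum>i<n. real (m i) * b i)"
      by (simp add: sum_distrib_left sum.distrib algebra_simps sum_subtractf)
    then show ?thesis
      unfolding exp_monomial
      using convex_onD[OF exp_convex, of t] assms by simp
  qed
  then have "f (\<lambda>i. exp ((1 - t) * a i + t * b i)) \<le>
      (\<Sum>m\<leftarrow>ms. (1 - t) * (\<Prod>i<n. exp (a i) ^ m i) + t * (\<Prod>i<n. exp (b i) ^ m i))"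
    unfolding ms by (intro sum_list_mono)
  then show ?thesis
    by (simp add: ms sum_list_addf sum_list_const_mult)
qed


section \<open>Schur polynomials\<close>

text \<open>
  The Gelfand-Tsetlin expansion of Schur polynomials: in the branching rule for \<open>l\<close>, the same
  product of differences appears as in the branching rule for the Vandermonde determinant, and
  sequences that interlace with \<open>l\<close> are again strictly decreasing.
\<close>

lemma alternant_factorization:
  assumes "strict_antimono_on {..<n} l"
  shows "\<exists>p. monomial_sum n p \<and> (\<forall>x. alternant n l x = vandermonde n x * p x)"
  using assms
proof (induction n arbitrary: l)
  case 0
  have "monomial_sum 0 (\<lambda>_. 1)"
    unfolding monomial_sum_def by (rule exI[of _ "[\<lambda>_. 0]"]) simp
  then show ?case
    by (intro exI[of _ "\<lambda>_. 1"]) (simp add: alternant_def)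
next
  case (Suc n)
  define K where "K = PiE {..<n} (\<lambda>j. {l (Suc j)..<l j})"
  have "strict_antimono_on {..<n} k" if "k \<in> K" for k
  proof (rule monotone_onI)
    fix i j assume ij: "i \<in> {..<n}" "j \<in> {..<n}" "i < j"
    have "k j < l j" "l (Suc i) \<le> k i"
      using that ij PiE_mem[of k "{..<n}" "\<lambda>j. {l (Suc j)..<l j}"] by (auto simp: K_def)
    moreover have "l j \<le> l (Suc i)"
      using monotone_onD[OF Suc.prems, of "Suc i" j] ij by (cases "j = Suc i") auto
    ultimately show "k j < k i" by simp
  qed
  then obtain P where P: "\<And>k. k \<in> K \<Longrightarrow> monomial_sum n (P k)"
      "\<And>k x. k \<in> K \<Longrightarrow> alternant n k x = vandermonde n x * P k x"
    using Suc.IH by metis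
  let ?e = "\<lambda>k. l n + (\<Sum>j<n. l j - 1 - k j)"
  have "finite K" unfolding K_def by (intro finite_PiE) auto
  then have "monomial_sum (Suc n) (\<lambda>x. \<Sum>k\<in>K. x n ^ ?e k * P k x)"
    by (intro monomial_sum_sum monomial_sum_new_variable P)
  moreover have "alternant (Suc n) l x = vandermonde (Suc n) x * (\<Sum>k\<in>K. x n ^ ?e k * P k x)" for x
    unfolding vandermonde_Suc alternant_branch[OF Suc.prems] K_def[symmetric]
    by (simp add: P(2) sum_distrib_left mult_ac)
  ultimately show ?case by blast
qed

lemma alternant_quotient_symmetric:
  assumes p: "\<And>x. alternant n a x = vandermonde n x * p x"
    and "\<pi> permutes {0..<n}" "inj_on x {..<n}"
  shows "p (\<lambda>i. x (\<pi> i)) = p x"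
proof -
  have "signof \<pi> * vandermonde n x * p (\<lambda>i. x (\<pi> i)) = alternant n a (\<lambda>i. x (\<pi> i))"
    using p[of "\<lambda>i. x (\<pi> i)"] unfolding alternant_permute[OF assms(2), of "staircase n" x] ..
  also have "\<dots> = signof \<pi> * vandermonde n x * p x"
    unfolding alternant_permute[OF assms(2), of a x] p[of x] by (rule mult.assoc[symmetric])
  finally have eq: "signof \<pi> * vandermonde n x * p (\<lambda>i. x (\<pi> i)) = signof \<pi> * vandermonde n x * p x" .
  have "signof \<pi> * vandermonde n x \<noteq> 0"
    using vandermonde_nonzero[OF assms(3)] by (simp add: sign_def)
  from iffD1[OF mult_left_cancel[OF this] eq] show ?thesis .
qed

lemma polynomial_fun_tendsto:
  assumes "polynomial_fun n f" "\<And>i. i < n \<Longrightarrow> ((\<lambda>t. X t i) \<longlongrightarrow> x i) F"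
  shows "((\<lambda>t. f (X t)) \<longlongrightarrow> f x) F"
proof -
  obtain M c where f: "\<And>x. f x = (\<Sum>m\<in>M. c m * (\<Prod>i<n. x i ^ m i))"
    using assms(1) unfolding polynomial_fun_def by blast
  show ?thesis
    unfolding f by (intro tendsto_intros assms(2)) auto
qed

lemma perturbation_tendsto:
  "((\<lambda>t. x i + t * real (Suc i)) \<longlongrightarrow> x i) (at_right 0)"
  by (auto intro!: tendsto_eq_intros)

text \<open>
  Points with distinct coordinates are dense.  The direction \<open>(1, 2, \<dots>, n)\<close> makes the coordinates
  distinct for small \<open>t\<close> and at the same time makes nonnegative coordinates positive.
\<close>

lemma eventually_perturbation_inj:
  fixes x :: "nat \<Rightarrow> real"
  shows "\<forall>\<^sub>F t in at_right 0. inj_on (\<lambda>i. x i + t * real (Suc i)) {..<n}"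
proof -
  have "\<forall>\<^sub>F t in at_right 0. \<forall>i\<in>{..<n}. \<forall>j\<in>{..<n}.
      i \<noteq> j \<longrightarrow> t \<noteq> (x i - x j) / (real j - real i)"
    by (intro eventually_ball_finite ballI eventually_mono[OF eventually_neq_at_within]) auto
  then show ?thesis
  proof eventually_elim
    case (elim t)
    show ?case
    proof (intro inj_onI)
      fix i j assume ij: "i \<in> {..<n}" "j \<in> {..<n}"
        and eq: "x i + t * real (Suc i) = x j + t * real (Suc j)"
      show "i = j"
      proof (rule ccontr)
        assume "i \<noteq> j"
        then have "t = (x i - x j) / (real j - real i)"
          using eq by (simp add: field_simps)
        then show False using elim ij \<open>i \<noteq> j\<close> by blast
      qed
    qed
  qed
qed

lemma polynomial_fun_eqI:
  assumes "polynomial_fun n f" "polynomial_fun n g"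
    and eq: "\<And>x. inj_on x {..<n} \<Longrightarrow> f x = g x"
  shows "f = g"
proof
  fix x
  let ?X = "\<lambda>t i. x i + t * real (Suc i)"
  have f: "((\<lambda>t. f (?X t)) \<longlongrightarrow> f x) (at_right 0)"
    by (intro polynomial_fun_tendsto[OF assms(1)] perturbation_tendsto)
  have g: "((\<lambda>t. g (?X t)) \<longlongrightarrow> g x) (at_right 0)"
    by (intro polynomial_fun_tendsto[OF assms(2)] perturbation_tendsto)
  have "\<forall>\<^sub>F t in at_right 0. f (?X t) = g (?X t)"
    using eventually_perturbation_inj[of x n] by eventually_elim (rule eq)
  from tendsto_unique[OF _ f] tendsto_cong[OF this] g show "f x = g x"
    by simp
qed

abbreviation shifted :: "nat \<Rightarrow> (nat \<Rightarrow> nat) \<Rightarrow> nat \<Rightarrow> nat" where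
  "shifted n l \<equiv> \<lambda>j. l j + (n - Suc j)"

lemma shifted_strict_antimono:
  assumes "int_partition n l"
  shows "strict_antimono_on {..<n} (shifted n l)"
proof (rule monotone_onI)
  fix i j assume "i \<in> {..<n}" "j \<in> {..<n}" "i < j"
  moreover from this have "l j \<le> l i"
    using monotone_onD[of "{..<n}" "(\<le>)" "(\<ge>)" l i j] assms by (auto simp: int_partition_def)
  ultimately show "shifted n l j < shifted n l i" by auto
qed

text \<open>
  The factor found in \<open>alternant_factorization\<close> satisfies the description that defines \<open>schur\<close>, and
  \<open>polynomial_fun_eqI\<close> shows that nothing else does.
\<close>

lemma
  assumes "int_partition n l"
  shows schur_monomial_sum: "monomial_sum n (schur n l)"
    and alternant_eq_schur: "alternant n (shifted n l) x = vandermonde n x * schur n l x"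
proof -
  obtain p where p: "monomial_sum n p"
      "\<And>x. alternant n (shifted n l) x = vandermonde n x * p x"
    using alternant_factorization[OF shifted_strict_antimono[OF assms]] by blast
  have "schur n l = p"
    unfolding schur_def
  proof (rule the_equality)
    show "polynomial_fun n p \<and> (\<forall>x. inj_on x {..<n} \<longrightarrow>
        p x = alternant n (shifted n l) x / vandermonde n x)"
      using p by (simp add: monomial_sum_imp_polynomial_fun vandermonde_nonzero)
  next
    fix f assume f: "polynomial_fun n f \<and> (\<forall>x. inj_on x {..<n} \<longrightarrow>
        f x = alternant n (shifted n l) x / vandermonde n x)"
    then show "f = p"
      using p vandermonde_nonzero
      by (intro polynomial_fun_eqI[of n]) (auto simp: monomial_sum_imp_polynomial_fun)
  qed
  with p show "monomial_sum n (schur n l)"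
      "alternant n (shifted n l) x = vandermonde n x * schur n l x"
    by simp_all
qed

lemma schur_tendsto:
  assumes "int_partition n l" "\<And>i. i < n \<Longrightarrow> ((\<lambda>t. X t i) \<longlongrightarrow> x i) F"
  shows "((\<lambda>t. schur n l (X t)) \<longlongrightarrow> schur n l x) F"
  using polynomial_fun_tendsto[OF monomial_sum_imp_polynomial_fun[OF schur_monomial_sum[OF assms(1)]],
      where X = X and x = x and F = F] assms(2)
  by blast

lemma schur_scale:
  assumes "int_partition n l" "inj_on x {..<n}" "c > 0"
  shows "schur n l (\<lambda>i. c * x i) = c ^ (\<Sum>i<n. l i) * schur n l x"
proof -
  have "c ^ (\<Sum>i<n. staircase n i) * vandermonde n x * schur n l (\<lambda>i. c * x i) =
      vandermonde n (\<lambda>i. c * x i) * schur n l (\<lambda>i. c * x i)"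
    by (subst alternant_scale) simp
  also have "\<dots> = c ^ (\<Sum>i<n. shifted n l i) * (vandermonde n x * schur n l x)"
    unfolding alternant_eq_schur[OF assms(1), symmetric] by (rule alternant_scale)
  also have "\<dots> = c ^ (\<Sum>i<n. staircase n i) * vandermonde n x * (c ^ (\<Sum>i<n. l i) * schur n l x)"
    unfolding sum.distrib power_add by (simp only: mult_ac)
  finally show ?thesis
    using vandermonde_nonzero[OF assms(2)] assms(3) by simp
qed

section \<open>Majorization of partitions\<close>

text \<open>
  Muirhead's chain of unit transfers.  Let \<open>j\<close> be the first position where \<open>m\<close> lies below \<open>l\<close>, and
  \<open>i\<close> the last position before \<open>j\<close> where \<open>m\<close> lies above \<open>l\<close>; the two agree strictly between.
  Moving a unit of \<open>m\<close> from \<open>i\<close> to \<open>j\<close> therefore keeps \<open>m\<close> decreasing.  It also keeps the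
  partial sums above those of \<open>l\<close>: the ones that drop end between \<open>i\<close> and \<open>j\<close>, where
  the sum for \<open>m\<close> was strictly larger.  The total excess of \<open>m\<close> over \<open>l\<close> decreases.
\<close>

lemma majorization_le:
  fixes F :: "(nat \<Rightarrow> nat) \<Rightarrow> real"
  assumes cong: "\<And>l m. (\<And>i. i < n \<Longrightarrow> l i = m i) \<Longrightarrow> F l = F m"
    and transfer: "\<And>m i j. int_partition n m \<Longrightarrow> i < j \<Longrightarrow> j < n \<Longrightarrow> m j + 2 \<le> m i \<Longrightarrow>
      F (m(i := m i - 1, j := m j + 1)) \<le> F m"
    and l: "int_partition n l"
    and m: "int_partition n m"
    and maj: "majorized n (\<lambda>i. real (l i)) (\<lambda>i. real (m i))"
  shows "F l \<le> F m"
  using m maj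
proof (induction "\<Sum>t<n. m t - l t" arbitrary: m rule: less_induct)
  case less
  \<comment> \<open>Truncated subtraction makes the measure count only the positions where \<open>m\<close> exceeds \<open>l\<close>.\<close>
  have anti: "l t \<le> l s" "m t \<le> m s" if "s \<le> t" "t < n" for s t
    using that l less.prems(1) unfolding int_partition_def monotone_on_def by auto
  have total: "(\<Sum>t<n. l t) = (\<Sum>t<n. m t)"
    using less.prems(2) unfolding majorized_def of_nat_sum[symmetric] of_nat_eq_iff by simp
  have partial: "(\<Sum>t<k. l t) \<le> (\<Sum>t<k. m t)" if "k \<le> n" for k
  proof (cases "k = 0 \<or> k = n")
    case False
    with that have "k \<in> {1..n - 1}" by auto
    then show ?thesis
      using less.prems(2) unfolding majorized_def of_nat_sum[symmetric] of_nat_le_iff by simp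
  qed (use total in auto)
  show ?case
  proof (cases "\<forall>t<n. l t = m t")
    case True
    then show ?thesis using cong[of l m] by simp
  next
    case False
    have "\<exists>j<n. m j < l j"
    proof (rule ccontr)
      assume "\<not> ?thesis"
      then have le: "\<forall>t\<in>{..<n}. l t \<le> m t" by (meson lessThan_iff not_less)
      with False have "\<exists>t\<in>{..<n}. l t < m t" by (meson le_neq_implies_less lessThan_iff)
      with le have "(\<Sum>t<n. l t) < (\<Sum>t<n. m t)"
        by (intro sum_strict_mono_ex1) auto
      with total show False by simp
    qed
    define j where "j = (LEAST j. j < n \<and> m j < l j)"
    have j: "j < n" "m j < l j"
      using LeastI_ex[OF \<open>\<exists>j<n. m j < l j\<close>] by (auto simp: j_def)
    have before_j: "l t \<le> m t" if "t < j" for t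
      using not_less_Least[of t "\<lambda>j. j < n \<and> m j < l j"] that j(1) by (auto simp: j_def)
    have "\<exists>i<j. l i < m i"
    proof (rule ccontr)
      assume "\<not> ?thesis"
      then have "(\<Sum>t<j. m t) \<le> (\<Sum>t<j. l t)" by (intro sum_mono) (meson lessThan_iff not_less)
      with partial[of "Suc j"] j show False by simp
    qed
    define i where "i = Max {i. i < j \<and> l i < m i}"
    have "i \<in> {i. i < j \<and> l i < m i}"
      unfolding i_def using \<open>\<exists>i<j. l i < m i\<close> by (intro Max_in) auto
    then have i: "i < j" "l i < m i" by auto
    have between: "m t = l t" if "i < t" "t < j" for t
    proof (rule ccontr)
      assume "m t \<noteq> l t"
      then have "t \<in> {i. i < j \<and> l i < m i}" using before_j[OF that(2)] that(2) by simp
      then have "t \<le> i" unfolding i_def by (intro Max_ge) auto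
      with that show False by simp
    qed
    have "l j \<le> l i" using anti(1)[of i j] i j by simp
    define m' where "m' = m(i := m i - 1, j := m j + 1)"
    have m': "m' i = m i - 1" "m' j = m j + 1" "\<And>t. t \<noteq> i \<Longrightarrow> t \<noteq> j \<Longrightarrow> m' t = m t"
      using i by (auto simp: m'_def)
    have "F m' \<le> F m"
      unfolding m'_def using less.prems(1) i j \<open>l j \<le> l i\<close> by (intro transfer) auto
    have "int_partition n m'"
      unfolding int_partition_def
    proof (rule monotone_onI)
      fix s t assume st: "s \<in> {..<n}" "t \<in> {..<n}" "s \<le> t"
      consider "s = t" | "s = i" "i < t" "t < j" | "s = i" "t = j" | "s = i" "j < t"
        | "i < s" "s < j" "t = j" | "s < i" "t = j" | "s < t" "s \<noteq> i" "t \<noteq> j"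
        using st i by linarith
      then show "m' t \<le> m' s"
      proof cases
        case 2
        then show ?thesis using between[of t] anti(1)[of i t] m' i st by auto
      next
        case 3
        then show ?thesis using m' i j \<open>l j \<le> l i\<close> by auto
      next
        case 4
        then show ?thesis using anti(2)[of j t] m' i j st \<open>l j \<le> l i\<close> by auto
      next
        case 5
        then show ?thesis using between[of s] anti(1)[of s j] m' i j by auto
      next
        case 6
        then show ?thesis using anti(2)[of s i] m' i j st \<open>l j \<le> l i\<close> by auto
      next
        case 7
        have "m' t \<le> m t" using 7 m' by (cases "t = i") auto
        also have "m t \<le> m s" using anti(2)[of s t] st by auto
        also have "m s \<le> m' s" using 7 m' by (cases "s = j") auto
        finally show ?thesis .
      qed simp
    qed
    have sum_m': "(\<Sum>t<k. m' t) + (if i < k then 1 else 0) = (\<Sum>t<k. m t) + (if j < k then 1 else 0)" for k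
    proof (induction k)
      case (Suc k)
      then show ?case using i m' by (cases "k = i"; cases "k = j") (auto split: if_splits)
    qed simp
    have "(\<Sum>t<k. l t) \<le> (\<Sum>t<k. m' t)" if "k \<le> n" for k
    proof (cases "i < k \<and> k \<le> j")
      case True
      then have "(\<Sum>t<k. l t) < (\<Sum>t<k. m t)"
        using i before_j by (intro sum_strict_mono_ex1) auto
      with sum_m'[of k] True show ?thesis by simp
    next
      case False
      with sum_m'[of k] partial[OF that] i show ?thesis by (auto split: if_splits)
    qed
    moreover have "(\<Sum>t<n. l t) = (\<Sum>t<n. m' t)"
      using sum_m'[of n] total i j by simp
    ultimately have "majorized n (\<lambda>i. real (l i)) (\<lambda>i. real (m' i))"
      unfolding majorized_def of_nat_sum[symmetric] of_nat_le_iff of_nat_eq_iff by auto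
    moreover have "(\<Sum>t<n. m' t - l t) < (\<Sum>t<n. m t - l t)"
    proof (rule sum_strict_mono_ex1)
      show "\<forall>t\<in>{..<n}. m' t - l t \<le> m t - l t"
        using m' j by (metis (no_types, lifting) Suc_eq_plus1 Suc_leI diff_is_0_eq diff_le_mono diff_le_self le0 order_refl)
      show "\<exists>t\<in>{..<n}. m' t - l t < m t - l t"
        using m' i j by (intro bexI[of _ i]) auto
    qed simp
    ultimately have "F l \<le> F m'"
      using less.hyps \<open>int_partition n m'\<close> by blast
    with \<open>F m' \<le> F m\<close> show ?thesis by simp
  qed
qed

section \<open>Monotonicity of normalized Schur polynomials\<close>

text \<open>
  The transferred sequence is the convex combination, with weights \<open>1 - t\<close> and \<open>t\<close>, of \<open>l\<close> and of
  \<open>l\<close> with the entries \<open>i\<close> and \<open>j\<close> exchanged, where \<open>t\<close> is the reciprocal of the gap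
  \<open>l i - l j\<close>.  By symmetry \<open>p\<close> takes the same value at both, so convexity gives the claim.
\<close>

lemma unit_transfer_le:
  fixes l :: "nat \<Rightarrow> nat"
  assumes p: "monomial_sum n p" "\<And>x. alternant n a x = vandermonde n x * p x"
    and l: "inj_on l {..<n}" and ij: "i < n" "j < n" "i \<noteq> j" "l j < l i" and s: "s > 0"
  shows "p (\<lambda>k. exp s ^ (l(i := l i - 1, j := l j + 1)) k) \<le> p (\<lambda>k. exp s ^ l k)"
proof -
  define l' where "l' = l(i := l i - 1, j := l j + 1)"
  let ?\<tau> = "Transposition.transpose i j"
  define t where "t = 1 / (real (l i) - real (l j))"
  have t: "0 \<le> t" "t \<le> 1" and t_eq: "t * (real (l i) - real (l j)) = 1"
    using ij by (auto simp: t_def field_simps)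
  have "s * real (l' k) = (1 - t) * (s * real (l k)) + t * (s * real (l (?\<tau> k)))" for k
  proof -
    have "real (l' k) = (1 - t) * real (l k) + t * real (l (?\<tau> k))"
      using t_eq ij by (cases "k = i"; cases "k = j") (auto simp: l'_def algebra_simps of_nat_diff)
    then show ?thesis by (simp only:) (simp add: algebra_simps)
  qed
  then have "p (\<lambda>k. exp (s * real (l' k))) =
      p (\<lambda>k. exp ((1 - t) * (s * real (l k)) + t * (s * real (l (?\<tau> k)))))"
    by simp
  also have "\<dots> \<le> (1 - t) * p (\<lambda>k. exp (s * real (l k))) + t * p (\<lambda>k. exp (s * real (l (?\<tau> k))))"
    using monomial_sum_exp_convex[OF p(1) t] .
  also have "p (\<lambda>k. exp (s * real (l (?\<tau> k)))) = p (\<lambda>k. exp (s * real (l k)))"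
    using ij l s
    by (intro alternant_quotient_symmetric[OF p(2), where x = "\<lambda>k. exp (s * real (l k))"]
        permutes_swap_id) (auto simp: inj_on_def)
  finally have "p (\<lambda>k. exp (s * real (l' k))) \<le> p (\<lambda>k. exp (s * real (l k)))"
    by (simp add: algebra_simps)
  moreover have "exp (s * real k) = exp s ^ k" for k
    by (metis exp_of_nat_mult mult.commute)
  ultimately show ?thesis unfolding l'_def[symmetric] by (simp only:)
qed

lemma vandermonde_powers_pos:
  fixes s :: real
  assumes "s > 0" "strict_antimono_on {..<n} b"
  shows "vandermonde n (\<lambda>i. exp s ^ b i) > 0"
  using assms by (intro vandermonde_pos) (auto simp: monotone_on_def)

lemma staircase_strict_antimono: "strict_antimono_on {..<n} (staircase n)"
  by (auto simp: monotone_on_def)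

lemma vandermonde_powers_eq_schur:
  assumes "int_partition n l"
  shows "vandermonde n (\<lambda>i. r ^ shifted n l i) =
    vandermonde n (\<lambda>i. r ^ staircase n i) * schur n l (\<lambda>i. r ^ staircase n i)"
  using alternant_eq_schur[OF assms] alternant_swap_powers by metis

lemma schur_staircase_powers_pos:
  fixes s :: real
  assumes "int_partition n l" "s > 0"
  shows "schur n l (\<lambda>i. exp s ^ staircase n i) > 0"
  using vandermonde_powers_pos[OF assms(2) shifted_strict_antimono[OF assms(1)]]
    vandermonde_powers_pos[OF assms(2) staircase_strict_antimono]
  unfolding vandermonde_powers_eq_schur[OF assms(1)] by (rule zero_less_mult_pos)

text \<open>
  Transposing both alternants cancels the Vandermonde determinant at \<open>r ^ shifted n l i\<close>, so that
  the partition \<open>l\<close> survives only in the argument of \<open>p\<close>.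
\<close>

lemma schur_ratio_at_powers:
  fixes s :: real
  assumes l: "int_partition n l" and s: "s > 0"
    and a: "strict_antimono_on {..<n} a"
    and p: "\<And>x. alternant n a x = vandermonde n x * p x"
  shows "schur n l (\<lambda>i. exp s ^ a i) / schur n l (\<lambda>i. exp s ^ staircase n i) =
      vandermonde n (\<lambda>i. exp s ^ staircase n i) / vandermonde n (\<lambda>i. exp s ^ a i) *
      p (\<lambda>i. exp s ^ shifted n l i)"
proof -
  have "vandermonde n (\<lambda>i. exp s ^ shifted n l i) * p (\<lambda>i. exp s ^ shifted n l i) =
      vandermonde n (\<lambda>i. exp s ^ a i) * schur n l (\<lambda>i. exp s ^ a i)"
    using alternant_eq_schur[OF l] alternant_swap_powers p by metis
  then show ?thesis
    using vandermonde_powers_pos[OF s a] schur_staircase_powers_pos[OF l s]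
    unfolding vandermonde_powers_eq_schur[OF l] by (simp add: field_simps)
qed

lemma schur_one_pos:
  assumes "int_partition n l"
  shows "schur n l (\<lambda>_. 1) > 0"
proof -
  have "schur n l (\<lambda>i. exp 1 ^ staircase n i) > 0"
    by (rule schur_staircase_powers_pos[OF assms]) simp
  then have "schur n l (\<lambda>i. exp 1 ^ staircase n i) \<noteq> 0" by simp
  then show ?thesis
    by (rule monomial_sum_one_pos[OF schur_monomial_sum[OF assms]])
qed

lemma schur_ratio_le_at_powers:
  fixes s :: real
  assumes lm: "int_partition n l" "int_partition n m"
    "majorized n (\<lambda>i. real (l i)) (\<lambda>i. real (m i))"
    and s: "s > 0" and a: "strict_antimono_on {..<n} a"
  shows "schur n l (\<lambda>i. exp s ^ a i) / schur n l (\<lambda>i. exp s ^ staircase n i) \<le>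
    schur n m (\<lambda>i. exp s ^ a i) / schur n m (\<lambda>i. exp s ^ staircase n i)"
proof -
  obtain p where p: "monomial_sum n p" "\<And>x. alternant n a x = vandermonde n x * p x"
    using alternant_factorization[OF a] by blast
  have p_cong: "p x = p y" if "\<And>i. i < n \<Longrightarrow> x i = y i" for x y
    using p(1) that unfolding monomial_sum_def by (metis (no_types, lifting) lessThan_iff map_cong prod.cong)
  define F where "F = (\<lambda>l. p (\<lambda>k. exp s ^ shifted n l k))"
  have "F l \<le> F m"
  proof (rule majorization_le[OF _ _ lm])
    fix m :: "nat \<Rightarrow> nat" and i j
    assume m: "int_partition n m" and ij: "i < j" "j < n" "m j + 2 \<le> m i"
    have "shifted n (m(i := m i - 1, j := m j + 1)) =
        (shifted n m)(i := shifted n m i - 1, j := shifted n m j + 1)"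
      using ij by (auto simp: fun_eq_iff)
    moreover have "inj_on (shifted n m) {..<n}"
      using shifted_strict_antimono[OF m] by (simp add: strict_antimono_iff_antimono)
    ultimately show "F (m(i := m i - 1, j := m j + 1)) \<le> F m"
      unfolding F_def using unit_transfer_le[OF p _ _ _ _ _ s, of "shifted n m" i j] ij
      by (simp add: fun_eq_iff)
  qed (auto simp: F_def intro: p_cong)
  moreover have "vandermonde n (\<lambda>i. exp s ^ staircase n i) / vandermonde n (\<lambda>i. exp s ^ a i) > 0"
    by (intro divide_pos_pos vandermonde_powers_pos s a staircase_strict_antimono)
  ultimately show ?thesis
    unfolding schur_ratio_at_powers[OF lm(1) s a p(2)] schur_ratio_at_powers[OF lm(2) s a p(2)] F_def
    by (intro mult_left_mono) auto
qed

lemma floor_div_tendsto: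
  fixes a :: real
  shows "((\<lambda>s. s * of_int \<lfloor>a / s\<rfloor>) \<longlongrightarrow> a) (at_right 0)"
proof (rule real_tendsto_sandwich)
  show "\<forall>\<^sub>F s in at_right 0. a - s \<le> s * of_int \<lfloor>a / s\<rfloor>"
    using eventually_at_right_less[of "0::real"]
  proof eventually_elim
    case (elim s)
    have "s * (a / s - 1) \<le> s * of_int \<lfloor>a / s\<rfloor>"
      using elim by (intro mult_left_mono) linarith+
    then show ?case using elim by (simp add: algebra_simps)
  qed
  show "\<forall>\<^sub>F s in at_right 0. s * of_int \<lfloor>a / s\<rfloor> \<le> a"
    using eventually_at_right_less[of "0::real"]
  proof eventually_elim
    case (elim s)
    have "s * of_int \<lfloor>a / s\<rfloor> \<le> s * (a / s)"
      using elim by (intro mult_left_mono) linarith+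
    then show ?case using elim by simp
  qed
qed (auto intro!: tendsto_eq_intros)

text \<open>
  With \<open>a s i = \<lfloor>ln (x i) / s\<rfloor>\<close>, the powers \<open>exp s ^ a s i\<close> tend to \<open>x i\<close> as \<open>s\<close> tends to 0, and the
  staircase powers tend to 1.  The exponents are strictly decreasing as soon as \<open>s\<close> is below all
  differences of the logarithms, and the lower bound 1 on the coordinates makes the exponents
  nonnegative.
\<close>

lemma normalized_schur_le_decreasing:
  assumes lm: "int_partition n l" "int_partition n m"
    "majorized n (\<lambda>i. real (l i)) (\<lambda>i. real (m i))"
    and x: "strict_antimono_on {..<n} x" "\<And>i. i < n \<Longrightarrow> x i > 1"
  shows "normalized_schur n l x \<le> normalized_schur n m x"
proof -
  define a where "a = (\<lambda>s i. nat \<lfloor>ln (x i) / s\<rfloor>)"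
  have "\<forall>\<^sub>F s in at_right 0. \<forall>i\<in>{..<n}. \<forall>j\<in>{..<n}. i < j \<longrightarrow> s < ln (x i) - ln (x j)"
  proof (intro eventually_ball_finite ballI)
    fix i j assume ij: "i \<in> {..<n}" "j \<in> {..<n}"
    show "\<forall>\<^sub>F s in at_right 0. i < j \<longrightarrow> s < ln (x i) - ln (x j)"
    proof (cases "i < j")
      case True
      then have "x j < x i" "x j > 1" using monotone_onD[OF x(1), of i j] x(2) ij by auto
      then have "0 < ln (x i) - ln (x j)" by simp
      from eventually_at_right_real[OF this] show ?thesis by eventually_elim auto
    qed simp
  qed auto
  then have dec: "\<forall>\<^sub>F s in at_right 0. strict_antimono_on {..<n} (a s)"
    using eventually_at_right_less[of "0::real"]
  proof eventually_elim
    case (elim s)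
    show ?case
    proof (rule monotone_onI)
      fix i j assume ij: "i \<in> {..<n}" "j \<in> {..<n}" "i < j"
      have "s < ln (x i) - ln (x j)" using elim ij by blast
      then have "ln (x j) / s + 1 < ln (x i) / s"
        using divide_strict_right_mono[OF _ elim(2), of s "ln (x i) - ln (x j)"] elim(2)
        by (simp add: diff_divide_distrib)
      moreover have "ln (x j) / s > 0" using x(2)[of j] ij elim(2) by simp
      ultimately show "a s j < a s i" unfolding a_def by linarith
    qed
  qed
  have "((\<lambda>s. exp s ^ a s i) \<longlongrightarrow> x i) (at_right 0)" if "i < n" for i
  proof -
    have "((\<lambda>s. exp (s * of_int \<lfloor>ln (x i) / s\<rfloor>)) \<longlongrightarrow> exp (ln (x i))) (at_right 0)"
      by (intro tendsto_exp floor_div_tendsto)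
    moreover have "\<forall>\<^sub>F s in at_right 0. exp (s * of_int \<lfloor>ln (x i) / s\<rfloor>) = exp s ^ a s i"
      using eventually_at_right_less[of "0::real"]
    proof eventually_elim
      case (elim s)
      then have "ln (x i) / s > 0" using x(2)[OF that] by simp
      then have "real (a s i) = of_int \<lfloor>ln (x i) / s\<rfloor>" unfolding a_def by simp
      then show ?case by (simp flip: exp_of_nat_mult add: mult.commute)
    qed
    ultimately show ?thesis
      using x(2)[OF that] by (simp add: tendsto_cong)
  qed
  moreover have "((\<lambda>s. exp s ^ staircase n i) \<longlongrightarrow> (1::real)) (at_right 0)" for i
    by (auto intro!: tendsto_eq_intros)
  ultimately have lim: "((\<lambda>s. schur n k (\<lambda>i. exp s ^ a s i) / schur n k (\<lambda>i. exp s ^ staircase n i))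
      \<longlongrightarrow> normalized_schur n k x) (at_right 0)" if "int_partition n k" for k
    unfolding normalized_schur_def using schur_one_pos[OF that]
    by (intro tendsto_divide schur_tendsto that) auto
  have "\<forall>\<^sub>F s in at_right 0.
      schur n l (\<lambda>i. exp s ^ a s i) / schur n l (\<lambda>i. exp s ^ staircase n i) \<le>
      schur n m (\<lambda>i. exp s ^ a s i) / schur n m (\<lambda>i. exp s ^ staircase n i)"
    using dec eventually_at_right_less[of "0::real"]
    by eventually_elim (intro schur_ratio_le_at_powers lm)
  then show ?thesis
    by (intro tendsto_le[OF _ lim[OF lm(2)] lim[OF lm(1)]]) auto
qed

lemma decreasing_rearrangement:
  fixes x :: "nat \<Rightarrow> real"
  assumes "inj_on x {..<n}"
  obtains \<pi> where "\<pi> permutes {0..<n}" "strict_antimono_on {..<n} (\<lambda>i. x (\<pi> i))"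
proof
  let ?ys = "rev (sort_key x [0..<n])"
  let ?\<pi> = "\<lambda>i. if i < n then ?ys ! i else i"
  have "bij_betw ((!) ?ys) {..<n} {..<n}"
    by (intro bij_betw_nth) (auto simp: lessThan_atLeast0)
  also have "?this \<longleftrightarrow> bij_betw ?\<pi> {..<n} {..<n}"
    by (rule bij_betw_cong) simp
  finally have bij: "bij_betw ?\<pi> {0..<n} {0..<n}"
    by (simp only: lessThan_atLeast0)
  then show "?\<pi> permutes {0..<n}"
    by (rule bij_imp_permutes) auto
  have "sorted_wrt (\<ge>) (map x ?ys)"
    by (simp add: rev_map[symmetric] sorted_wrt_rev)
  then have le: "x (?\<pi> j) \<le> x (?\<pi> i)" if "i < j" "j < n" for i j
    using sorted_wrt_nth_less[of "(\<ge>)" "map x ?ys" i j] that by simp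
  have ne: "x (?\<pi> j) \<noteq> x (?\<pi> i)" if "i < j" "j < n" for i j
  proof -
    have "?\<pi> j \<noteq> ?\<pi> i"
      using inj_on_eq_iff[OF bij_betw_imp_inj_on[OF bij], of j i] that by simp
    moreover have "?\<pi> i \<in> {..<n}" "?\<pi> j \<in> {..<n}"
      using bij_betwE[OF bij] that by auto
    ultimately show ?thesis
      using inj_on_eq_iff[OF assms] by blast
  qed
  show "strict_antimono_on {..<n} (\<lambda>i. x (?\<pi> i))"
  proof (rule monotone_onI)
    fix i j assume "i \<in> {..<n}" "j \<in> {..<n}" "i < j"
    then have "i < j" "j < n" by simp_all
    from order.not_eq_order_implies_strict[OF ne[OF this] le[OF this]] show "x (?\<pi> j) < x (?\<pi> i)" .
  qed
qed

text \<open>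
  Both sides are symmetric, and homogeneous of the same degree since \<open>l\<close> and \<open>m\<close> have equal sums;
  so the coordinates may be sorted and scaled to lie above 1.
\<close>

lemma normalized_schur_le_distinct:
  assumes lm: "int_partition n l" "int_partition n m"
    "majorized n (\<lambda>i. real (l i)) (\<lambda>i. real (m i))"
    and x: "inj_on x {..<n}" "\<And>i. i < n \<Longrightarrow> x i > 0"
  shows "normalized_schur n l x \<le> normalized_schur n m x"
proof -
  obtain \<pi> where \<pi>: "\<pi> permutes {0..<n}" "strict_antimono_on {..<n} (\<lambda>i. x (\<pi> i))"
    using decreasing_rearrangement[OF x(1)] .
  have \<pi>_less: "\<pi> i < n" if "i < n" for i
    using permutes_in_image[OF \<pi>(1), of i] that by simp
  \<comment> \<open>Any scale above all \<open>1 / x i\<close> works; the sum avoids a maximum over a possibly empty set.\<close>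
  define c where "c = 1 + (\<Sum>i<n. 1 / x i)"
  have "c > 0" unfolding c_def using x(2) by (intro add_pos_nonneg sum_nonneg) (auto simp: less_imp_le)
  have c: "c * x i > 1" if "i < n" for i
  proof -
    have "1 / x i \<le> (\<Sum>i<n. 1 / x i)"
      using x(2) that by (intro member_le_sum) (auto simp: less_imp_le)
    then have "1 / x i < c" by (simp add: c_def)
    then show ?thesis using x(2)[OF that] by (simp add: field_simps)
  qed
  have "strict_antimono_on {..<n} (\<lambda>i. c * x (\<pi> i))"
    using \<pi>(2) \<open>c > 0\<close> by (auto simp: monotone_on_def)
  then have le: "normalized_schur n l (\<lambda>i. c * x (\<pi> i)) \<le> normalized_schur n m (\<lambda>i. c * x (\<pi> i))"
    using c \<pi>_less by (intro normalized_schur_le_decreasing lm) auto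
  have inj: "inj_on (\<lambda>i. c * x i) {..<n}"
    using x(1) \<open>c > 0\<close> by (auto simp: inj_on_def)
  have eq: "normalized_schur n k (\<lambda>i. c * x (\<pi> i)) = c ^ (\<Sum>i<n. k i) * normalized_schur n k x"
    if "int_partition n k" for k
    using alternant_quotient_symmetric[OF alternant_eq_schur[OF that] \<pi>(1) inj]
      schur_scale[OF that x(1) \<open>c > 0\<close>]
    by (simp add: normalized_schur_def)
  have "(\<Sum>i<n. l i) = (\<Sum>i<n. m i)"
    using lm(3) unfolding majorized_def of_nat_sum[symmetric] of_nat_eq_iff by simp
  with le \<open>c > 0\<close> show ?thesis
    by (simp add: eq lm(1,2))
qed

theorem theorem2:
  fixes n :: nat and l m :: "nat \<Rightarrow> nat" and x :: "nat \<Rightarrow> real"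
  assumes "n \<ge> 1"
    and "int_partition n l" and "int_partition n m"
    and "majorized n (\<lambda>i. real (l i)) (\<lambda>i. real (m i))"
    and "\<And>i. i < n \<Longrightarrow> x i \<ge> 0"
  shows "normalized_schur n l x \<le> normalized_schur n m x"
proof -
  let ?X = "\<lambda>t i. x i + t * real (Suc i)"
  have lim: "((\<lambda>t. normalized_schur n k (?X t)) \<longlongrightarrow> normalized_schur n k x) (at_right 0)"
    if "int_partition n k" for k
    unfolding normalized_schur_def using schur_one_pos[OF that]
    by (intro tendsto_divide schur_tendsto[OF that] tendsto_const perturbation_tendsto) auto
  have "\<forall>\<^sub>F t in at_right 0. normalized_schur n l (?X t) \<le> normalized_schur n m (?X t)"
    using eventually_perturbation_inj[of x n] eventually_at_right_less[of "0::real"]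
  proof eventually_elim
    case (elim t)
    then show ?case
      using assms(5)
      by (intro normalized_schur_le_distinct assms(2-4)) (auto intro!: add_nonneg_pos)
  qed
  then show ?thesis
    by (intro tendsto_le[OF _ lim[OF assms(3)] lim[OF assms(2)]]) auto
qed

end
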